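(* Consider the Diophantine system $$xy = v^2,\qquad yz = w^2$$ in positive integers $x, y, z, v, w$. A quintuple $(x,y,z,v,w)$ of positive integers is a solution of this system if and only if there exist positive integers $c, h, i, j, e, f, r, t$ with $\gcd(i,j)=1$ and $\gcd(e,f)=1$ such that $$x = c\,h\,e^2 j^2 r^2,\qquad y = c\,h^3 e^2 j^4 i^2 f^2,\qquad z = c\,h\,i^2 t^2,$$ $$v = c\,i\,f\,r\,h^2 e^2 j^3,\qquad w = c\,e\,f\,t\,h^2 i^2 j^2 .$$ *)

theory Defs
  imports Main
begin

end

theory Submission
  imports Defs "HOL-Computational_Algebra.Squarefree"
begin

text \<open>
  Write \<open>y = s b\<^sup>2\<close> with \<open>s\<close> squarefree. Since \<open>x y\<close> and \<open>y z\<close> are squares, \<open>x\<close> and \<open>z\<close> have the same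
  squarefree part, so \<open>x = s a\<^sup>2\<close>, \<open>z = s d\<^sup>2\<close>, \<open>v = s a b\<close> and \<open>w = s b d\<close>. This is already of
  the required shape with \<open>c = s\<close>, \<open>r = a\<close>, \<open>f = b\<close>, \<open>t = d\<close> and \<open>h = i = j = e = 1\<close>.
\<close>

text \<open>With \<open>g = gcd s u\<close>, the cofactor \<open>s'\<close> of \<open>g\<close> in
  \<open>s\<close> is coprime to that of \<open>u\<close>, so it must divide \<open>g\<close>. Then
  \<open>s' ^ 2\<close> divides \<open>s\<close>, which forces \<open>s' = 1\<close>.\<close>

lemma squarefree_dvd_power2_imp_dvd:
  fixes s u :: nat
  assumes "squarefree s" and "s dvd u ^ 2"
  shows "s dvd u"
proof -
  have "s > 0"
    using assms(1) by (cases "s = 0") auto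
  then obtain s' u' where s: "s = s' * gcd s u" and u: "u = u' * gcd s u" and "coprime s' u'"
    using gcd_coprime_exists[of s u] by auto
  \<comment> \<open>Grouped so that one nonzero factor \<open>gcd s u\<close> cancels on the
    right.\<close>
  have "s' * gcd s u dvd (gcd s u * u' ^ 2) * gcd s u"
    using assms(2) s u by (metis mult.assoc mult.commute power2_eq_square)
  then have "s' dvd gcd s u * u' ^ 2"
    using \<open>s > 0\<close> by simp
  then have "s' dvd gcd s u"
    using \<open>coprime s' u'\<close> by (simp add: coprime_dvd_mult_left_iff)
  then have "s' ^ 2 dvd s"
    using s by (metis mult_dvd_mono dvd_refl power2_eq_square)
  then have "s' = 1"
    using squarefreeD[OF assms(1)] by simp
  then show ?thesis
    using s by (metis gcd_dvd2 mult_1)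
qed

text \<open>Cancelling \<open>b ^ 2\<close> makes \<open>x * s\<close> a square
  \<open>u ^ 2\<close>; then \<open>s\<close> divides \<open>u\<close>, and one factor
  \<open>s\<close> cancels.\<close>

lemma mult_eq_square_squarefree_factor:
  fixes s b x v :: nat
  assumes "squarefree s" and "b > 0" and "x * (s * b ^ 2) = v ^ 2"
  obtains a where "x = s * a ^ 2" and "v = s * a * b"
proof -
  have "b ^ 2 dvd v ^ 2"
    by (metis assms(3) dvd_triv_right mult.assoc)
  then have "b dvd v"
    by simp
  then obtain u where v: "v = u * b"
    by (metis dvdE mult.commute)
  have xs: "x * s = u ^ 2"
    using assms(2,3) by (simp add: v power_mult_distrib flip: mult.assoc)
  then have "s dvd u"
    using squarefree_dvd_power2_imp_dvd[OF assms(1)] by (metis dvd_triv_right)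
  then obtain a where u: "u = s * a" ..
  have "s > 0"
    using assms(1) by (cases "s = 0") auto
  then have "x = s * a ^ 2"
    using xs by (simp add: u power2_eq_square algebra_simps)
  then show ?thesis
    using that v u by blast
qed

theorem theorem8:
  fixes x y z v w :: nat
  assumes "x > 0" and "y > 0" and "z > 0" and "v > 0" and "w > 0"
  shows "x * y = v^2 \<and> y * z = w^2 \<longleftrightarrow>
    (\<exists>c h i j e f r t :: nat.
       c > 0 \<and> h > 0 \<and> i > 0 \<and> j > 0 \<and> e > 0 \<and> f > 0 \<and> r > 0 \<and> t > 0 \<and>
       gcd i j = 1 \<and> gcd e f = 1 \<and>
       x = c * h * e^2 * j^2 * r^2 \<and>
       y = c * h^3 * e^2 * j^4 * i^2 * f^2 \<and>
       z = c * h * i^2 * t^2 \<and>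
       v = c * i * f * r * h^2 * e^2 * j^3 \<and>
       w = c * e * f * t * h^2 * i^2 * j^2)"
    (is "?sys \<longleftrightarrow> ?param")
proof
  assume sys: ?sys
  define s b where "s = squarefree_part y" and "b = square_part y"
  have s: "squarefree s" and y: "y = s * b ^ 2"
    unfolding s_def b_def using squarefree_decompose[of y] by auto
  have "s > 0" "b > 0"
    using assms(2) y by (auto intro!: Nat.gr0I)
  obtain a where a: "x = s * a ^ 2" "v = s * a * b"
    using mult_eq_square_squarefree_factor[OF s \<open>b > 0\<close>] sys y by metis
  obtain d where d: "z = s * d ^ 2" "w = s * d * b"
    using mult_eq_square_squarefree_factor[OF s \<open>b > 0\<close>] sys y by (metis mult.commute)
  have "a > 0" "d > 0"
    using assms(4,5) a d by auto
  show ?param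
    by (rule exI[of _ s], rule exI[of _ 1], rule exI[of _ 1], rule exI[of _ 1], rule exI[of _ 1],
        rule exI[of _ b], rule exI[of _ a], rule exI[of _ d])
      (use \<open>s > 0\<close> \<open>b > 0\<close> \<open>a > 0\<close> \<open>d > 0\<close> y a d in \<open>simp add: algebra_simps\<close>)
next
  assume ?param
  \<comment> \<open>After substitution both equations are identities between monomials; unfolding
    the numeral exponents turns powers into products.\<close>
  then show ?sys
    by (elim exE conjE) (simp add: eval_nat_numeral algebra_simps)
qed

end
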